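(* Let $V$ be a finite set, let $P$ be an irreducible transition kernel on $V$ with stationary distribution $\pi$, and let $\{X_t\}_{t\ge0}$ be the continuous-time chain that moves at rate $1$ according to $P$, i.e. the chain with transition kernel $h_t=e^{t(P-I)}$. Let $\Phi$ be the conductance profile of $P$ and let $\epsilon>0$. Then the $\epsilon$-uniform mixing time satisfies $$\tau(\epsilon)\le\int_{4\pi_*}^{4/\epsilon}\frac{8\,du}{u\,\Phi^2(u)}.$$ More precisely, for all $x,y\in V$ and all real $t\ge0$, if $$t\ge\int_{4(\pi(x)\wedge\pi(y))}^{4/\epsilon}\frac{8\,du}{u\,\Phi^2(u)},$$ then $$\left|\frac{h_t(x,y)-\pi(y)}{\pi(y)}\right|\le\epsilon.$$
   Context: $\alpha\wedge\beta=\min\{\alpha,\beta\}$ and $\pi_*=\min_{x\in V}\pi(x)$. No reversibility and no lower bound on the holding probabilities $P(x,x)$ is assumed. For $x,y\in V$ let $Q(x,y)=\pi(x)P(x,y)$, and for $S,A\subset V$ let $Q(S,A)=\sum_{s\in S,a\in A}Q(s,a)$. For nonempty $S\subset V$ let $\Phi_S=Q(S,S^c)/\pi(S)$. The conductance profile of $P$ is $\Phi(r)=\inf\{\Phi_S:\ \emptyset\ne S\subset V,\ \pi(S)\le r\}$ for $0<r\le 1/2$, and $\Phi(r)=\Phi(1/2)$ for $r>1/2$ (with $\inf\emptyset=+\infty$, $1/\infty=0$). The $\epsilon$-uniform mixing time of the continuous-time chain is $$\tau(\epsilon)=\min\left\{t\ge0:\ \left|\frac{h_t(x,y)-\pi(y)}{\pi(y)}\right|\le\epsilon\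 \text{ for all }x,y\in V\right\}.$$ In the bound for $\tau(\epsilon)$, the integral is interpreted as $0$ if its lower limit is greater than or equal to its upper limit. *)

theory Defs
  imports "HOL-Analysis.Analysis"
begin

text \<open>The state space is a finite type \<open>'v\<close>; the kernel entry \<open>P(x,y)\<close> is \<open>P $ x $ y\<close>.\<close>

definition transition_kernel :: "real^'v^'v \<Rightarrow> bool" where
  "transition_kernel P \<longleftrightarrow> (\<forall>x y. 0 \<le> P $ x $ y) \<and> (\<forall>x. (\<Sum>y\<in>UNIV. P $ x $ y) = 1)"

text \<open>The power \<open>^\<close> and the product \<open>*\<close> on \<open>real^'v^'v\<close> are not those of matrices.\<close>

primrec matrix_power :: "real^'v^'v \<Rightarrow> nat \<Rightarrow> real^'v^'v" where
  "matrix_power A 0 = mat 1"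
| "matrix_power A (Suc n) = A ** matrix_power A n"

definition irreducible_kernel :: "real^'v^'v \<Rightarrow> bool" where
  "irreducible_kernel P \<longleftrightarrow> (\<forall>x y. \<exists>n. 0 < matrix_power P n $ x $ y)"

definition stationary_distribution :: "real^'v^'v \<Rightarrow> real^'v \<Rightarrow> bool" where
  "stationary_distribution P \<pi> \<longleftrightarrow>
     (\<forall>x. 0 \<le> \<pi> $ x) \<and> (\<Sum>x\<in>UNIV. \<pi> $ x) = 1 \<and> \<pi> v* P = \<pi>"

definition matrix_exp :: "real^'v^'v \<Rightarrow> real^'v^'v" where
  "matrix_exp A = (\<Sum>n. (1 / fact n) *\<^sub>R matrix_power A n)"

definition heat_kernel :: "real^'v^'v \<Rightarrow> real \<Rightarrow> real^'v^'v" where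
  "heat_kernel P t = matrix_exp (t *\<^sub>R (P - mat 1))"

definition set_mass :: "real^'v \<Rightarrow> 'v set \<Rightarrow> real" where
  "set_mass \<pi> S = (\<Sum>x\<in>S. \<pi> $ x)"

definition edge_flow :: "real^'v^'v \<Rightarrow> real^'v \<Rightarrow> 'v set \<Rightarrow> 'v set \<Rightarrow> real" where
  "edge_flow P \<pi> S A = (\<Sum>s\<in>S. \<Sum>a\<in>A. \<pi> $ s * P $ s $ a)"

definition set_conductance :: "real^'v^'v \<Rightarrow> real^'v \<Rightarrow> 'v set \<Rightarrow> real" where
  "set_conductance P \<pi> S = edge_flow P \<pi> S (- S) / set_mass \<pi> S"

text \<open>Values in \<open>ennreal\<close> make the infimum of the empty set equal to \<open>\<infinity>\<close>, with \<open>1 / \<infinity> = 0\<close>.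
  Only arguments \<open>r > 0\<close> matter.\<close>

definition conductance_profile :: "real^'v^'v \<Rightarrow> real^'v \<Rightarrow> real \<Rightarrow> ennreal" where
  "conductance_profile P \<pi> r =
     (INF S\<in>{S. S \<noteq> {} \<and> set_mass \<pi> S \<le> min r (1/2)}. ennreal (set_conductance P \<pi> S))"

text \<open>The Lebesgue integral over \<open>{a..b}\<close> is \<open>0\<close> when \<open>a \<ge> b\<close>.\<close>

definition profile_integral :: "real^'v^'v \<Rightarrow> real^'v \<Rightarrow> real \<Rightarrow> real \<Rightarrow> ennreal" where
  "profile_integral P \<pi> a b =
     (\<integral>\<^sup>+u\<in>{a..b}. 8 / (ennreal u * (conductance_profile P \<pi> u)\<^sup>2) \<partial>lborel)"

text \<open>The mixing time is a genuine minimum: \<open>LEAST\<close> on the reals is unspecified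
  unless the set of admissible times has a least element.\<close>

definition uniform_mixing_time :: "real^'v^'v \<Rightarrow> real^'v \<Rightarrow> real \<Rightarrow> real" where
  "uniform_mixing_time P \<pi> \<epsilon> =
     (LEAST t. 0 \<le> t \<and> (\<forall>x y. \<bar>(heat_kernel P t $ x $ y - \<pi> $ y) / \<pi> $ y\<bar> \<le> \<epsilon>))"

end

theory Submission
  imports Defs
begin

text \<open>The proof follows the variance of the density of the chain with respect to \<open>\<pi>\<close>. For
  \<open>f t = h_t(x,\<cdot>) / \<pi>\<close> and \<open>V t = \<pi>((f t)\<^sup>2) - 1\<close> one has \<open>V' = - 2 E(f t)\<close>, where
  \<open>E f = 1/2 \<Sum> Q(x,y) (f x - f y)\<^sup>2\<close> is the Dirichlet form of the flow \<open>Q(x,y) = \<pi>(x) P(x,y)\<close>.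
  The form depends on the chain only through its additive symmetrization, which is why the argument
  covers non-reversible chains.

  The heart of the matter is the bound \<open>\<Phi>(4 / V)\<^sup>2 / 4 * V \<le> E f\<close> for densities \<open>f\<close> of variance
  \<open>V\<close> (\<open>dirichlet_ge_variance\<close>): a large variance forces \<open>f\<close> to live on a small set, up to a
  truncation, and for functions supported on small sets Cheeger's argument (\<open>coarea\<close>, \<open>cheeger\<close>)
  bounds the Dirichlet form below by the conductance of small sets. Consequently
  \<open>V' \<le> - \<Phi>(4 / V)\<^sup>2 / 2 * V\<close>. Since \<open>V 0 < 1 / \<pi>(x)\<close>, the substitution \<open>u = 4 / V\<close> shows that
  \<open>V\<close> falls to \<open>\<epsilon>\<close> within half of the time \<open>\<integral> 8 du / (u \<Phi>(u)\<^sup>2)\<close> over \<open>[4 \<pi>(x), 4 / \<epsilon>]\<close>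
  (\<open>variance_decay\<close>).

  The same holds for \<open>h_t(\<cdot>,y) / \<pi>(y)\<close>. By the semigroup law, the deviation
  \<open>h_{2s}(x,y) / \<pi>(y) - 1\<close> is the \<open>\<pi>\<close>-inner product of the two centred densities at time \<open>s\<close>,
  hence at most \<open>\<epsilon>\<close> once both variances are (\<open>heat_kernel_deviation\<close>). The bound on the mixing
  time is the case of a smallest \<open>\<pi>(x)\<close>.\<close>

section \<open>Conductance and the Dirichlet form of a flow\<close>

text \<open>The ergodic flow \<open>Q(x,y) = \<pi>(x) P(x,y)\<close> of a stationary chain need not be symmetric,
  but it has the same marginal \<open>\<pi>\<close> in both directions. The functional inequalities below
  use only this, and hence hold for non-reversible chains.\<close>

locale circulation =
  fixes Q :: "'v::finite \<Rightarrow> 'v \<Rightarrow> real" and m :: "'v \<Rightarrow> real"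
  assumes Q_nonneg: "0 \<le> Q x y"
    and outflow: "(\<Sum>y\<in>UNIV. Q x y) = m x"
    and inflow: "(\<Sum>x\<in>UNIV. Q x y) = m y"
begin

lemma m_nonneg: "0 \<le> m x"
  using sum_nonneg[of UNIV "Q x"] Q_nonneg by (simp add: outflow)

definition dirichlet :: "('v \<Rightarrow> real) \<Rightarrow> real" where
  "dirichlet f = (\<Sum>x\<in>UNIV. \<Sum>y\<in>UNIV. Q x y * (f x - f y)\<^sup>2) / 2"

lemma sum_Q_left: "(\<Sum>x\<in>UNIV. \<Sum>y\<in>UNIV. Q x y * f x) = (\<Sum>x\<in>UNIV. m x * f x)"
  by (simp add: outflow flip: sum_distrib_right)

lemma sum_Q_right: "(\<Sum>x\<in>UNIV. \<Sum>y\<in>UNIV. Q x y * f y) = (\<Sum>x\<in>UNIV. m x * f x)"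
  by (subst sum.swap) (simp add: inflow flip: sum_distrib_right)

lemma dirichlet_nonneg: "0 \<le> dirichlet f"
  unfolding dirichlet_def by (intro divide_nonneg_nonneg sum_nonneg mult_nonneg_nonneg Q_nonneg) auto

lemma dirichlet_eq:
  "dirichlet f = (\<Sum>x\<in>UNIV. m x * (f x)\<^sup>2) - (\<Sum>x\<in>UNIV. \<Sum>y\<in>UNIV. Q x y * (f x * f y))"
proof -
  have "Q x y * (f x - f y)\<^sup>2 = Q x y * (f x)\<^sup>2 + Q x y * (f y)\<^sup>2 - 2 * (Q x y * (f x * f y))" for x y
    by (simp add: power2_eq_square algebra_simps)
  then have "2 * dirichlet f = (\<Sum>x\<in>UNIV. m x * (f x)\<^sup>2) + (\<Sum>x\<in>UNIV. m x * (f x)\<^sup>2)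
      - 2 * (\<Sum>x\<in>UNIV. \<Sum>y\<in>UNIV. Q x y * (f x * f y))"
    unfolding dirichlet_def
    by (simp add: sum_subtractf sum.distrib sum_Q_left sum_Q_right flip: sum_distrib_left)
  then show ?thesis by simp
qed

lemma dirichlet_contraction:
  assumes "\<And>x y. \<bar>g x - g y\<bar> \<le> \<bar>f x - f y\<bar>"
  shows "dirichlet g \<le> dirichlet f"
  unfolding dirichlet_def using assms
  by (intro divide_right_mono sum_mono mult_left_mono Q_nonneg) (auto simp: abs_le_square_iff)

text \<open>For \<open>A\<close> of mass at most \<open>min r (1/2)\<close>, any \<open>\<phi>\<close> below the conductance profile at \<open>r\<close>
  qualifies.\<close>

definition expands :: "real \<Rightarrow> 'v set \<Rightarrow> bool" where
  "expands \<phi> A \<longleftrightarrow> (\<forall>S. S \<noteq> {} \<longrightarrow> S \<subseteq> A \<longrightarrow> \<phi> * sum m S \<le> (\<Sum>x\<in>S. \<Sum>y\<in>-S. Q x y))"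

text \<open>A nonnegative function is a positive combination of the indicators of its superlevel sets, and
  both sides are additive along this decomposition. The induction peels off the smallest
  positive value \<open>a\<close>, that is, the term \<open>a * indicator S\<close> where \<open>S\<close> is the support.\<close>

lemma coarea:
  assumes "expands \<phi> {x. 0 < F x}" and "\<And>x. 0 \<le> F x"
  shows "\<phi> * (\<Sum>x\<in>UNIV. m x * F x) \<le> (\<Sum>x\<in>UNIV. \<Sum>y\<in>UNIV. Q x y * max 0 (F x - F y))"
  using assms
proof (induction "card {x. 0 < F x}" arbitrary: F rule: less_induct)
  case less
  define S where "S = {x. 0 < F x}"
  show ?case
  proof (cases "S = {}")
    case True
    then have "F x = 0" for x
      using less.prems(2)[of x] by (auto simp: S_def not_less order.antisym)
    then show ?thesis by simp
  next
    case False
    \<comment> \<open>Every nonzero value of \<open>F\<close> is at least \<open>a\<close>, so subtracting \<open>a\<close> on \<open>S\<close> keeps \<open>F\<close> nonnegative and shrinks its support.\<close>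
    define a where "a = Min (F ` S)"
    have a_le: "a \<le> F x" if "x \<in> S" for x using that by (simp add: a_def)
    have "a \<in> F ` S" unfolding a_def using False by (intro Min_in) auto
    then obtain x0 where x0: "x0 \<in> S" "F x0 = a" by auto
    then have "0 < a" by (auto simp: S_def)
    define F' where "F' x = F x - (if x \<in> S then a else 0)" for x
    have F'_nonneg: "0 \<le> F' x" for x
      using a_le less.prems(2)[of x] by (auto simp: F'_def)
    have sub: "{x. 0 < F' x} \<subseteq> S"
      by (auto simp: F'_def S_def split: if_splits)
    moreover have "x0 \<notin> {x. 0 < F' x}" using x0 by (simp add: F'_def)
    ultimately have "{x. 0 < F' x} \<subset> S" using x0 by blast
    then have "card {x. 0 < F' x} < card {x. 0 < F x}"
      unfolding S_def by (intro psubset_card_mono) auto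
    moreover have "expands \<phi> {x. 0 < F' x}"
      using less.prems(1) sub unfolding expands_def S_def by blast
    ultimately have IH: "\<phi> * (\<Sum>x\<in>UNIV. m x * F' x)
        \<le> (\<Sum>x\<in>UNIV. \<Sum>y\<in>UNIV. Q x y * max 0 (F' x - F' y))"
      using less.hyps F'_nonneg by blast
    have split: "max 0 (F x - F y) = max 0 (F' x - F' y) + a * (indicator S x * indicator (-S) y)" for x y
    proof -
      have "F z = 0" if "z \<notin> S" for z
        using that less.prems(2)[of z] by (auto simp: S_def not_less order.antisym)
      then show ?thesis
        using a_le[of x] a_le[of y] \<open>0 < a\<close>
        by (cases "x \<in> S"; cases "y \<in> S") (auto simp: F'_def)
    qed
    have "\<phi> * (\<Sum>x\<in>UNIV. m x * F x) = \<phi> * (\<Sum>x\<in>UNIV. m x * F' x) + a * (\<phi> * sum m S)"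
    proof -
      have "m x * F x = m x * F' x + a * (m x * indicator S x)" for x
        by (auto simp: F'_def algebra_simps)
      then have "(\<Sum>x\<in>UNIV. m x * F x) = (\<Sum>x\<in>UNIV. m x * F' x) + a * (\<Sum>x\<in>UNIV. m x * indicator S x)"
        by (simp only: sum.distrib sum_distrib_left)
      then show ?thesis by (simp add: algebra_simps)
    qed
    also have "\<dots> \<le> (\<Sum>x\<in>UNIV. \<Sum>y\<in>UNIV. Q x y * max 0 (F' x - F' y))
        + a * (\<Sum>x\<in>S. \<Sum>y\<in>-S. Q x y)"
      using less.prems(1) False \<open>0 < a\<close>
      by (intro add_mono IH mult_left_mono) (auto simp: expands_def S_def)
    also have "(\<Sum>x\<in>S. \<Sum>y\<in>-S. Q x y)
        = (\<Sum>x\<in>UNIV. \<Sum>y\<in>UNIV. Q x y * (indicator S x * indicator (-S) y))"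
    proof -
      have "(\<Sum>y\<in>UNIV. Q x y * (indicator S x * indicator (-S) y)) = (\<Sum>y\<in>-S. Q x y) * indicator S x" for x
      proof -
        have "(\<Sum>y\<in>UNIV. Q x y * (indicator S x * indicator (-S) y))
            = (\<Sum>y\<in>UNIV. Q x y * indicator (-S) y) * indicator S x"
          by (subst sum_distrib_right) (simp only: mult_ac)
        also have "(\<Sum>y\<in>UNIV. Q x y * indicator (-S) y) = (\<Sum>y\<in>-S. Q x y)"
          by (rule sum.mono_neutral_cong_right) auto
        finally show ?thesis .
      qed
      then show ?thesis by simp
    qed
    also have "(\<Sum>x\<in>UNIV. \<Sum>y\<in>UNIV. Q x y * max 0 (F' x - F' y)) + a * \<dots>
        = (\<Sum>x\<in>UNIV. \<Sum>y\<in>UNIV. Q x y * max 0 (F x - F y))"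
      by (simp only: split distrib_left sum.distrib sum_distrib_left mult_ac)
    finally show ?thesis .
  qed
qed

text \<open>The inequality of Cheeger type: apply the coarea bound to \<open>g\<^sup>2\<close> and factor
  \<open>(g x)\<^sup>2 - (g y)\<^sup>2\<close>. The Cauchy-Schwarz step is replaced by a weighted arithmetic-geometric
  mean inequality with weight \<open>1/\<phi>\<close>, after which half of the left-hand side is absorbed.\<close>

lemma cheeger:
  assumes exp: "expands \<phi> {x. 0 < g x}" and g: "\<And>x. 0 \<le> g x" and "0 \<le> \<phi>"
  shows "\<phi>\<^sup>2 / 2 * (\<Sum>x\<in>UNIV. m x * (g x)\<^sup>2) \<le> dirichlet g"
proof (cases "\<phi> = 0")
  case True
  then show ?thesis by (simp add: dirichlet_nonneg)
next
  case False
  with \<open>0 \<le> \<phi>\<close> have "0 < \<phi>" by simp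
  define G where "G = (\<Sum>x\<in>UNIV. m x * (g x)\<^sup>2)"
  have supp: "{x. 0 < (g x)\<^sup>2} = {x. 0 < g x}"
    using g by (auto simp: less_le)
  have "\<phi> * G \<le> (\<Sum>x\<in>UNIV. \<Sum>y\<in>UNIV. Q x y * max 0 ((g x)\<^sup>2 - (g y)\<^sup>2))"
    unfolding G_def using exp by (intro coarea) (auto simp only: supp zero_le_power2)
  \<comment> \<open>The flow through each level is the same upwards and downwards, as the marginals agree.\<close>
  also have "\<dots> = (\<Sum>x\<in>UNIV. \<Sum>y\<in>UNIV. Q x y * \<bar>(g x)\<^sup>2 - (g y)\<^sup>2\<bar>) / 2"
  proof -
    have "2 * (Q x y * max 0 ((g x)\<^sup>2 - (g y)\<^sup>2))
        = Q x y * \<bar>(g x)\<^sup>2 - (g y)\<^sup>2\<bar> + (Q x y * (g x)\<^sup>2 - Q x y * (g y)\<^sup>2)" for x y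
      by (auto simp: algebra_simps max_def)
    then have "2 * (\<Sum>x\<in>UNIV. \<Sum>y\<in>UNIV. Q x y * max 0 ((g x)\<^sup>2 - (g y)\<^sup>2))
        = (\<Sum>x\<in>UNIV. \<Sum>y\<in>UNIV. Q x y * \<bar>(g x)\<^sup>2 - (g y)\<^sup>2\<bar>)"
      by (simp add: sum_distrib_left sum.distrib sum_subtractf sum_Q_left sum_Q_right)
    then show ?thesis by simp
  qed
  also have "\<dots> \<le> (\<Sum>x\<in>UNIV. \<Sum>y\<in>UNIV. Q x y * ((g x - g y)\<^sup>2 / \<phi> + \<phi> / 2 * ((g x)\<^sup>2 + (g y)\<^sup>2))) / 2"
  proof (intro divide_right_mono sum_mono mult_left_mono Q_nonneg)
    fix x y
    define d s where "d = \<bar>g x - g y\<bar>" and "s = g x + g y"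
    have "0 \<le> (2 * d - \<phi> * s)\<^sup>2" by simp
    then have "4 * \<phi> * (d * s) \<le> 4 * d\<^sup>2 + \<phi>\<^sup>2 * s\<^sup>2"
      by (simp add: power2_eq_square algebra_simps)
    then have "d * s \<le> d\<^sup>2 / \<phi> + \<phi> / 4 * s\<^sup>2"
      using \<open>0 < \<phi>\<close> by (simp add: field_simps power2_eq_square)
    moreover have "s\<^sup>2 \<le> 2 * ((g x)\<^sup>2 + (g y)\<^sup>2)"
      using zero_le_power2[of "g x - g y"] unfolding s_def by (simp add: power2_eq_square algebra_simps)
    then have "\<phi> / 4 * s\<^sup>2 \<le> \<phi> / 4 * (2 * ((g x)\<^sup>2 + (g y)\<^sup>2))"
      using \<open>0 < \<phi>\<close> by (intro mult_left_mono) auto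
    moreover have "\<bar>(g x)\<^sup>2 - (g y)\<^sup>2\<bar> = d * s"
      using g[of x] g[of y] by (simp add: d_def s_def power2_eq_square square_diff_square_factored abs_mult)
    moreover have "d\<^sup>2 = (g x - g y)\<^sup>2" by (simp add: d_def)
    ultimately show "\<bar>(g x)\<^sup>2 - (g y)\<^sup>2\<bar> \<le> (g x - g y)\<^sup>2 / \<phi> + \<phi> / 2 * ((g x)\<^sup>2 + (g y)\<^sup>2)"
      by (simp add: algebra_simps)
  qed simp
  also have "\<dots> = dirichlet g / \<phi> + \<phi> / 2 * G"
  proof -
    have "Q x y * ((g x - g y)\<^sup>2 / \<phi> + \<phi> / 2 * ((g x)\<^sup>2 + (g y)\<^sup>2))
        = Q x y * (g x - g y)\<^sup>2 / \<phi> + \<phi> / 2 * (Q x y * (g x)\<^sup>2) + \<phi> / 2 * (Q x y * (g y)\<^sup>2)" for x y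
      by (simp add: algebra_simps)
    then show ?thesis
      unfolding dirichlet_def G_def
      by (simp add: sum.distrib sum_Q_left sum_Q_right flip: sum_distrib_left sum_divide_distrib)
  qed
  finally show ?thesis
    using \<open>0 < \<phi>\<close> by (simp add: G_def field_simps power2_eq_square)
qed

lemma markov:
  assumes "\<And>x. 0 \<le> f x" and "0 < c"
  shows "sum m {x. c < f x} \<le> (\<Sum>x\<in>UNIV. m x * f x) / c"
proof -
  have "c * sum m {x. c < f x} \<le> (\<Sum>x\<in>{x. c < f x}. m x * f x)"
    unfolding sum_distrib_left
    by (rule sum_mono) (use m_nonneg in \<open>simp add: mult.commute[of c] mult_left_mono\<close>)
  also have "\<dots> \<le> (\<Sum>x\<in>UNIV. m x * f x)"
    using assms m_nonneg by (intro sum_mono2) auto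
  finally show ?thesis using \<open>0 < c\<close> by (simp add: field_simps)
qed

lemma median_exists:
  fixes f :: "'v \<Rightarrow> real"
  assumes total: "sum m UNIV = 1"
  obtains c where "sum m {x. c < f x} \<le> 1/2" and "sum m {x. f x < c} \<le> 1/2"
proof -
  \<comment> \<open>The least value of \<open>f\<close> with at most half of the mass above it is a median.\<close>
  define A where "A = {v \<in> range f. sum m {x. v < f x} \<le> 1/2}"
  have "{x. Max (range f) < f x} = {}" by (auto simp: not_less)
  then have "sum m {x. Max (range f) < f x} \<le> 1/2" by (simp only: sum.empty)
  moreover have "Max (range f) \<in> range f" by (intro Max_in) auto
  ultimately have "A \<noteq> {}" unfolding A_def by blast
  have "finite A" by (simp add: A_def)
  define c where "c = Min A"
  have "c \<in> A" unfolding c_def using \<open>finite A\<close> \<open>A \<noteq> {}\<close> by (rule Min_in)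
  have "sum m {x. f x < c} \<le> 1/2"
  proof (cases "{x. f x < c} = {}")
    case False
    define b where "b = Max (f ` {x. f x < c})"
    have "b \<in> f ` {x. f x < c}" unfolding b_def using False by (intro Max_in) auto
    then have "b < c" "b \<in> range f" by auto
    then have "b \<notin> A" using Min_le[OF \<open>finite A\<close>, of b] by (auto simp: c_def)
    then have "1/2 < sum m {x. b < f x}" using \<open>b \<in> range f\<close> by (auto simp: A_def)
    moreover have "{x. f x < c} = UNIV - {x. b < f x}"
    proof (intro equalityI subsetI)
      fix x assume "x \<in> {x. f x < c}"
      then have "f x \<le> b" unfolding b_def by (intro Max_ge) auto
      then show "x \<in> UNIV - {x. b < f x}" by simp
    qed (use \<open>b < c\<close> in auto)
    ultimately show ?thesis using total by (simp add: sum_diff)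
  qed simp
  moreover have "sum m {x. c < f x} \<le> 1/2" using \<open>c \<in> A\<close> by (simp add: A_def)
  ultimately show thesis by (rule that[rotated])
qed

lemma expands_if_small:
  assumes "\<And>S. S \<noteq> {} \<Longrightarrow> sum m S \<le> r \<Longrightarrow> \<phi> * sum m S \<le> (\<Sum>x\<in>S. \<Sum>y\<in>-S. Q x y)"
    and "sum m A \<le> r"
  shows "expands \<phi> A"
  unfolding expands_def
proof (intro allI impI)
  fix S assume S: "S \<noteq> {}" "S \<subseteq> A"
  then have "sum m S \<le> sum m A" using m_nonneg by (intro sum_mono2) auto
  with assms S show "\<phi> * sum m S \<le> (\<Sum>x\<in>S. \<Sum>y\<in>-S. Q x y)" by simp
qed

text \<open>The spectral-profile inequality: a density \<open>f\<close> of variance \<open>V\<close> is so concentrated that sets of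
  mass at most \<open>4 / V\<close> already control its Dirichlet form. Truncating \<open>f\<close> below at \<open>V / 4\<close>
  leaves, by Markov's inequality, a function supported on such a set, and costs only half of the
  variance. When \<open>4 / V\<close> exceeds \<open>1/2\<close> this support may be too large for the conductance
  profile; then the parts of \<open>f\<close> above and below a median each have support of mass at most
  \<open>1/2\<close>.\<close>

lemma dirichlet_ge_variance:
  assumes total: "sum m UNIV = 1"
    and f: "\<And>x. 0 \<le> f x" and mean: "(\<Sum>x\<in>UNIV. m x * f x) = 1"
    and V: "V = (\<Sum>x\<in>UNIV. m x * (f x)\<^sup>2) - 1" "0 < V"
    and "0 \<le> \<phi>"
    and \<phi>: "\<And>S. S \<noteq> {} \<Longrightarrow> sum m S \<le> min (4 / V) (1/2) \<Longrightarrow>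
      \<phi> * sum m S \<le> (\<Sum>x\<in>S. \<Sum>y\<in>-S. Q x y)"
  shows "\<phi>\<^sup>2 / 4 * V \<le> dirichlet f"
proof (cases "4 / V \<le> 1/2")
  case True
  define g where "g x = max 0 (f x - V / 4)" for x
  have "{x. 0 < g x} = {x. V / 4 < f x}" by (auto simp: g_def)
  moreover have "sum m {x. V / 4 < f x} \<le> 4 / V"
    using markov[of f "V / 4"] f mean \<open>0 < V\<close> by simp
  ultimately have "expands \<phi> {x. 0 < g x}"
    using True by (intro expands_if_small[where r = "min (4 / V) (1/2)"] \<phi>) auto
  then have 1: "\<phi>\<^sup>2 / 2 * (\<Sum>x\<in>UNIV. m x * (g x)\<^sup>2) \<le> dirichlet g"
    by (intro cheeger \<open>0 \<le> \<phi>\<close>) (auto simp: g_def)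
  have second_moment: "(\<Sum>x\<in>UNIV. m x * (f x)\<^sup>2) = V + 1" using V by simp
  have "V / 2 \<le> (\<Sum>x\<in>UNIV. m x * (f x)\<^sup>2) - V / 2 * (\<Sum>x\<in>UNIV. m x * f x)"
    unfolding second_moment mean by (simp add: field_simps)
  also have "\<dots> = (\<Sum>x\<in>UNIV. m x * ((f x)\<^sup>2 - V / 2 * f x))"
    by (simp add: algebra_simps sum_subtractf sum_distrib_left)
  also have "\<dots> \<le> (\<Sum>x\<in>UNIV. m x * (g x)\<^sup>2)"
  proof (intro sum_mono mult_left_mono m_nonneg)
    fix x
    show "(f x)\<^sup>2 - V / 2 * f x \<le> (g x)\<^sup>2"
    proof (cases "V / 4 \<le> f x")
      case True
      then have "(g x)\<^sup>2 = (f x)\<^sup>2 - V / 2 * f x + (V / 4)\<^sup>2"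
        by (simp add: g_def max_def power2_eq_square algebra_simps)
      then show ?thesis by simp
    next
      case False
      then have "f x * (f x - V / 2) \<le> 0"
        using f[of x] \<open>0 < V\<close> by (intro mult_nonneg_nonpos) auto
      then have "(f x)\<^sup>2 - V / 2 * f x \<le> 0" by (simp add: power2_eq_square algebra_simps)
      then show ?thesis using zero_le_power2[of "g x"] by linarith
    qed
  qed
  finally have "\<phi>\<^sup>2 / 2 * (V / 2) \<le> \<phi>\<^sup>2 / 2 * (\<Sum>x\<in>UNIV. m x * (g x)\<^sup>2)"
    by (intro mult_left_mono) auto
  also note 1
  also have "dirichlet g \<le> dirichlet f"
    by (rule dirichlet_contraction) (auto simp: g_def)
  finally show ?thesis by simp
next
  case False
  obtain c where c: "sum m {x. c < f x} \<le> 1/2" "sum m {x. f x < c} \<le> 1/2"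
    using median_exists[OF total] by blast
  define g h where "g x = max 0 (f x - c)" and "h x = max 0 (c - f x)" for x
  have supp: "{x. 0 < g x} = {x. c < f x}" "{x. 0 < h x} = {x. f x < c}"
    by (auto simp: g_def h_def)
  have "expands \<phi> {x. 0 < g x}" "expands \<phi> {x. 0 < h x}"
    unfolding supp using c False
    by (auto intro!: expands_if_small[where r = "min (4 / V) (1/2)"] \<phi>)
  then have 1: "\<phi>\<^sup>2 / 2 * (\<Sum>x\<in>UNIV. m x * (g x)\<^sup>2) \<le> dirichlet g"
      "\<phi>\<^sup>2 / 2 * (\<Sum>x\<in>UNIV. m x * (h x)\<^sup>2) \<le> dirichlet h"
    using \<open>0 \<le> \<phi>\<close> by (intro cheeger; simp add: g_def h_def)+
  \<comment> \<open>The second moment about any point is at least the variance.\<close>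
  have "V \<le> V + (1 - c)\<^sup>2" by simp
  also have "\<dots> = (\<Sum>x\<in>UNIV. m x * (f x)\<^sup>2) - 2 * c * (\<Sum>x\<in>UNIV. m x * f x) + c\<^sup>2 * sum m UNIV"
    using V mean total by (simp add: power2_eq_square algebra_simps)
  also have "\<dots> = (\<Sum>x\<in>UNIV. m x * (f x - c)\<^sup>2)"
    by (simp add: power2_eq_square algebra_simps sum_subtractf sum.distrib sum_distrib_left)
  also have "\<dots> = (\<Sum>x\<in>UNIV. m x * (g x)\<^sup>2 + m x * (h x)\<^sup>2)"
    by (intro sum.cong) (auto simp: g_def h_def max_def power2_commute)
  finally have "V \<le> (\<Sum>x\<in>UNIV. m x * (g x)\<^sup>2) + (\<Sum>x\<in>UNIV. m x * (h x)\<^sup>2)"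
    by (simp add: sum.distrib)
  then have "\<phi>\<^sup>2 / 2 * V \<le> \<phi>\<^sup>2 / 2 * ((\<Sum>x\<in>UNIV. m x * (g x)\<^sup>2) + (\<Sum>x\<in>UNIV. m x * (h x)\<^sup>2))"
    by (intro mult_left_mono) auto
  also have "\<dots> \<le> dirichlet g + dirichlet h"
    using 1 by (simp add: algebra_simps)
  also have "\<dots> \<le> dirichlet f"
  proof -
    \<comment> \<open>The supports of \<open>g\<close> and \<open>h\<close> are disjoint, so the mixed term has a sign.\<close>
    have "(g x - g y)\<^sup>2 + (h x - h y)\<^sup>2 \<le> (f x - f y)\<^sup>2" for x y
    proof -
      have "f x - f y = (g x - g y) - (h x - h y)" by (simp add: g_def h_def)
      moreover have "(g x - g y) * (h x - h y) = - (g x * h y) - g y * h x"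
        by (auto simp: g_def h_def max_def algebra_simps)
      moreover have "0 \<le> g x * h y" "0 \<le> g y * h x" by (auto simp: g_def h_def)
      moreover have "((g x - g y) - (h x - h y))\<^sup>2
          = (g x - g y)\<^sup>2 + (h x - h y)\<^sup>2 - 2 * ((g x - g y) * (h x - h y))"
        by (simp add: power2_diff)
      ultimately show ?thesis by simp
    qed
    then have "(\<Sum>x\<in>UNIV. \<Sum>y\<in>UNIV. Q x y * ((g x - g y)\<^sup>2 + (h x - h y)\<^sup>2))
        \<le> (\<Sum>x\<in>UNIV. \<Sum>y\<in>UNIV. Q x y * (f x - f y)\<^sup>2)"
      by (intro sum_mono mult_left_mono Q_nonneg)
    then show ?thesis by (simp add: dirichlet_def sum.distrib algebra_simps)
  qed
  finally have "\<phi>\<^sup>2 / 2 * V \<le> dirichlet f" .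
  moreover have "0 \<le> \<phi>\<^sup>2 / 4 * V" using \<open>0 < V\<close> by simp
  ultimately show ?thesis by simp
qed

end

section \<open>The heat kernel\<close>

lemma matrix_power_commute: "matrix_power A n ** A = A ** matrix_power A n"
  by (induction n) (simp_all flip: matrix_mul_assoc)

lemma matrix_power_scaleR: "matrix_power (t *\<^sub>R A) n = t ^ n *\<^sub>R matrix_power A n"
  by (induction n) (simp_all add: matrix_scalar_ac scalar_matrix_assoc[symmetric])

lemma matrix_power_nonneg:
  assumes "\<And>x y. 0 \<le> A $ x $ y"
  shows "0 \<le> matrix_power A n $ x $ y"
proof (induction n arbitrary: x y)
  case (Suc n)
  then show ?case using assms by (simp add: matrix_matrix_mult_def sum_nonneg)
qed (simp add: mat_def)

lemma summable_matrix_exp: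
  fixes A :: "real^'v^'v"
  shows "summable (\<lambda>n. (t ^ n / fact n) *\<^sub>R matrix_power A n)"
proof -
  have "linear (\<lambda>B :: real^'v^'v. A ** B)"
    by (rule linearI) (simp_all add: matrix_add_ldistrib matrix_scalar_ac scalar_matrix_assoc[symmetric])
  then obtain K where "0 < K" and K: "\<And>B :: real^'v^'v. norm (A ** B) \<le> K * norm B"
    using linear_bounded_pos by blast
  have bound: "norm (matrix_power A n) \<le> K ^ n * norm (mat 1 :: real^'v^'v)" for n
  proof (induction n)
    case (Suc n)
    have "norm (matrix_power A (Suc n)) \<le> K * norm (matrix_power A n)" using K by simp
    also have "\<dots> \<le> K * (K ^ n * norm (mat 1 :: real^'v^'v))"
      using Suc \<open>0 < K\<close> by (intro mult_left_mono) auto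
    finally show ?case by (simp add: mult.assoc)
  qed simp
  show ?thesis
  proof (rule summable_comparison_test')
    show "summable (\<lambda>n. inverse (fact n) * (\<bar>t\<bar> * K) ^ n * norm (mat 1 :: real^'v^'v))"
      by (intro summable_mult2 summable_exp)
    fix n :: nat
    have "norm ((t ^ n / fact n) *\<^sub>R matrix_power A n) = \<bar>t\<bar> ^ n / fact n * norm (matrix_power A n)"
      by (simp add: power_abs)
    also have "\<dots> \<le> \<bar>t\<bar> ^ n / fact n * (K ^ n * norm (mat 1 :: real^'v^'v))"
      by (intro mult_left_mono bound) auto
    finally show "norm ((t ^ n / fact n) *\<^sub>R matrix_power A n)
        \<le> inverse (fact n) * (\<bar>t\<bar> * K) ^ n * norm (mat 1 :: real^'v^'v)"
      by (simp add: power_mult_distrib field_simps)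
  qed
qed

lemma sums_matrix_exp:
  "(\<lambda>n. (matrix_power A n $ x $ y / fact n) * t ^ n) sums (matrix_exp (t *\<^sub>R A) $ x $ y)"
proof -
  have "(\<lambda>n. (t ^ n / fact n) *\<^sub>R matrix_power A n) sums matrix_exp (t *\<^sub>R A)"
    using summable_sums[OF summable_matrix_exp[of t A]]
    by (simp add: matrix_exp_def matrix_power_scaleR)
  from bounded_linear.sums[OF bounded_linear_vec_nth bounded_linear.sums[OF bounded_linear_vec_nth this]]
  show ?thesis by (simp add: mult.commute)
qed

lemma matrix_exp_0:
  fixes A :: "real^'v^'v"
  shows "matrix_exp (0 *\<^sub>R A) = mat 1"
proof -
  have "matrix_exp (0 *\<^sub>R A) $ x $ y = (mat 1 :: real^'v^'v) $ x $ y" for x y :: 'v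
    using sums_unique2[OF sums_matrix_exp[of A x y 0] powser_sums_zero] by simp
  then show ?thesis by (simp add: vec_eq_iff)
qed

lemma DERIV_matrix_exp:
  "((\<lambda>t. matrix_exp (t *\<^sub>R A) $ x $ y) has_real_derivative
     (A ** matrix_exp (t *\<^sub>R A)) $ x $ y) (at t)"
  "((\<lambda>t. matrix_exp (t *\<^sub>R A) $ x $ y) has_real_derivative
     (matrix_exp (t *\<^sub>R A) ** A) $ x $ y) (at t)"
proof -
  define c where "c n = matrix_power A n $ x $ y / fact n" for n
  have "diffs c n = matrix_power A (Suc n) $ x $ y / fact n" for n
    by (simp add: diffs_def c_def del: matrix_power.simps)
  then have diffs: "diffs c n * t ^ n = (A ** matrix_power A n) $ x $ y / fact n * t ^ n" for n
    by simp
  have 0: "((\<lambda>t. matrix_exp (t *\<^sub>R A) $ x $ y) has_real_derivative (\<Sum>n. diffs c n * t ^ n)) (at t)"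
    using termdiffs_strong_converges_everywhere[of c t] sums_matrix_exp[of A x y]
    by (simp add: c_def sums_iff)
  have "(\<lambda>n. \<Sum>z\<in>UNIV. A $ x $ z * ((matrix_power A n $ z $ y / fact n) * t ^ n)) sums
      (\<Sum>z\<in>UNIV. A $ x $ z * matrix_exp (t *\<^sub>R A) $ z $ y)"
    by (intro sums_sum sums_mult sums_matrix_exp)
  then have "(\<lambda>n. diffs c n * t ^ n) sums (A ** matrix_exp (t *\<^sub>R A)) $ x $ y"
    unfolding diffs by (simp add: matrix_matrix_mult_def sum_distrib_left sum_distrib_right sum_divide_distrib mult_ac)
  with 0 show "((\<lambda>t. matrix_exp (t *\<^sub>R A) $ x $ y) has_real_derivative
     (A ** matrix_exp (t *\<^sub>R A)) $ x $ y) (at t)" by (simp add: sums_iff)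
  have "(\<lambda>n. \<Sum>z\<in>UNIV. ((matrix_power A n $ x $ z / fact n) * t ^ n) * A $ z $ y) sums
      (\<Sum>z\<in>UNIV. matrix_exp (t *\<^sub>R A) $ x $ z * A $ z $ y)"
    by (intro sums_sum sums_mult2 sums_matrix_exp)
  then have "(\<lambda>n. diffs c n * t ^ n) sums (matrix_exp (t *\<^sub>R A) ** A) $ x $ y"
    unfolding diffs matrix_power_commute[symmetric]
    by (simp add: matrix_matrix_mult_def sum_distrib_left sum_distrib_right sum_divide_distrib mult_ac)
  with 0 show "((\<lambda>t. matrix_exp (t *\<^sub>R A) $ x $ y) has_real_derivative
     (matrix_exp (t *\<^sub>R A) ** A) $ x $ y) (at t)" by (simp add: sums_iff)
qed

text \<open>Multiplying a solution of \<open>U' = A U\<close> by the integrating factor \<open>exp ((t - s) A)\<close> gives a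
  function of \<open>s\<close> with zero derivative. The semigroup law and the identity
  \<open>exp (t (P - 1)) = exp (- t) exp (t P)\<close> both follow from this uniqueness, so that no product
  of exponential series has to be multiplied out.\<close>

lemma linear_ode_unique:
  fixes U :: "real \<Rightarrow> real^'v^'v"
  assumes U: "\<And>s x y. ((\<lambda>s. U s $ x $ y) has_real_derivative (A ** U s) $ x $ y) (at s)"
  shows "U t = matrix_exp (t *\<^sub>R A) ** U 0"
proof -
  define W where "W s = matrix_exp ((t - s) *\<^sub>R A) ** U s" for s
  have "((\<lambda>s. W s $ x $ y) has_real_derivative 0) (at s)" for s x y
  proof -
    let ?E = "matrix_exp ((t - s) *\<^sub>R A)"
    have "((\<lambda>s. \<Sum>z\<in>UNIV. matrix_exp ((t - s) *\<^sub>R A) $ x $ z * U s $ z $ y) has_real_derivative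
        (\<Sum>z\<in>UNIV. (?E ** A) $ x $ z * (-1) * U s $ z $ y + (A ** U s) $ z $ y * ?E $ x $ z)) (at s)"
      by (intro DERIV_sum DERIV_mult U DERIV_chain2[OF DERIV_matrix_exp(2)])
        (auto intro!: derivative_eq_intros)
    moreover have "(\<Sum>z\<in>UNIV. (?E ** A) $ x $ z * (-1) * U s $ z $ y + (A ** U s) $ z $ y * ?E $ x $ z)
        = (?E ** (A ** U s)) $ x $ y - ((?E ** A) ** U s) $ x $ y"
      by (simp add: matrix_matrix_mult_def[of _ "A ** U s"] matrix_matrix_mult_def[of "?E ** A"]
          sum.distrib sum_negf sum_subtractf mult.commute)
    ultimately show ?thesis
      by (simp add: W_def matrix_matrix_mult_def[of "matrix_exp _"] matrix_mul_assoc)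
  qed
  then have "W t $ x $ y = W 0 $ x $ y" for x y
    using DERIV_isconst_all[of "\<lambda>s. W s $ x $ y"] by blast
  then have "W t = W 0" by (simp add: vec_eq_iff)
  moreover have "W t = U t" using matrix_exp_0[of A] by (simp add: W_def)
  ultimately show ?thesis by (simp add: W_def)
qed

lemma matrix_diff_mult: "(A - B) ** C = A ** C - B ** (C :: real^'n^'m)"
  by (simp add: matrix_matrix_mult_def vec_eq_iff left_diff_distrib sum_subtractf)

lemma DERIV_heat_kernel:
  "((\<lambda>t. heat_kernel P t $ x $ y) has_real_derivative ((P - mat 1) ** heat_kernel P t) $ x $ y) (at t)"
  "((\<lambda>t. heat_kernel P t $ x $ y) has_real_derivative (heat_kernel P t ** (P - mat 1)) $ x $ y) (at t)"
  unfolding heat_kernel_def by (rule DERIV_matrix_exp)+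

lemma heat_kernel_0: "heat_kernel P 0 = mat 1"
  unfolding heat_kernel_def by (rule matrix_exp_0)

lemma heat_kernel_add: "heat_kernel P (s + t) = heat_kernel P s ** heat_kernel P t"
proof -
  have "((\<lambda>s. heat_kernel P (s + t) $ x $ y) has_real_derivative
      ((P - mat 1) ** heat_kernel P (s + t)) $ x $ y) (at s)" for s x y
    using DERIV_heat_kernel(1)[of P x y "s + t"] by (simp add: DERIV_shift)
  from linear_ode_unique[OF this, of s] show ?thesis by (simp add: heat_kernel_def)
qed

text \<open>In this form all terms of the series are nonnegative: the chain makes a Poisson number of steps
  of \<open>P\<close>.\<close>

lemma heat_kernel_eq_exp: "heat_kernel P t = exp (- t) *\<^sub>R matrix_exp (t *\<^sub>R P)"
proof -
  have "((\<lambda>t. (exp (- t) *\<^sub>R matrix_exp (t *\<^sub>R P)) $ x $ y) has_real_derivative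
      ((P - mat 1) ** (exp (- t) *\<^sub>R matrix_exp (t *\<^sub>R P))) $ x $ y) (at t)" for t x y
  proof -
    let ?M = "matrix_exp (t *\<^sub>R P)"
    have "((\<lambda>t. exp (- t) * matrix_exp (t *\<^sub>R P) $ x $ y) has_real_derivative
        - exp (- t) * ?M $ x $ y + (P ** ?M) $ x $ y * exp (- t)) (at t)"
      by (intro DERIV_mult DERIV_matrix_exp(1)) (auto intro!: derivative_eq_intros)
    moreover have "((P - mat 1) ** (exp (- t) *\<^sub>R ?M)) $ x $ y
        = - exp (- t) * ?M $ x $ y + (P ** ?M) $ x $ y * exp (- t)"
      by (simp add: matrix_scalar_ac matrix_diff_mult scalar_matrix_assoc[symmetric] algebra_simps)
    ultimately show ?thesis by simp
  qed
  from linear_ode_unique[OF this, of t] show ?thesis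
    using matrix_exp_0[of P] by (simp add: heat_kernel_def)
qed

lemma heat_kernel_nonneg:
  assumes "transition_kernel P" "0 \<le> t"
  shows "0 \<le> heat_kernel P t $ x $ y"
proof -
  have "0 \<le> matrix_power P n $ x $ y / fact n * t ^ n" for n
    using assms by (intro mult_nonneg_nonneg divide_nonneg_nonneg matrix_power_nonneg)
      (auto simp: transition_kernel_def)
  then have "0 \<le> matrix_exp (t *\<^sub>R P) $ x $ y"
    by (rule sums_le[OF _ sums_zero sums_matrix_exp])
  then show ?thesis by (simp add: heat_kernel_eq_exp)
qed

lemma heat_kernel_row_sum:
  assumes "transition_kernel P"
  shows "(\<Sum>y\<in>UNIV. heat_kernel P t $ x $ y) = 1"
proof -
  have "((\<lambda>t. \<Sum>y\<in>UNIV. heat_kernel P t $ x $ y) has_real_derivative 0) (at t)" for t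
  proof -
    have "(\<Sum>y\<in>UNIV. (heat_kernel P t ** (P - mat 1)) $ x $ y)
        = (\<Sum>z\<in>UNIV. heat_kernel P t $ x $ z * (\<Sum>y\<in>UNIV. (P - mat 1) $ z $ y))"
      unfolding matrix_matrix_mult_def by (simp add: sum_distrib_left, subst sum.swap, rule refl)
    also have "\<dots> = 0"
      using assms by (simp add: transition_kernel_def sum_subtractf mat_def)
    finally have "(\<Sum>y\<in>UNIV. (heat_kernel P t ** (P - mat 1)) $ x $ y) = 0" .
    moreover have "((\<lambda>t. \<Sum>y\<in>UNIV. heat_kernel P t $ x $ y) has_real_derivative
        (\<Sum>y\<in>UNIV. (heat_kernel P t ** (P - mat 1)) $ x $ y)) (at t)"
      by (intro DERIV_sum DERIV_heat_kernel(2))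
    ultimately show ?thesis by (simp only:)
  qed
  then have "(\<Sum>y\<in>UNIV. heat_kernel P t $ x $ y) = (\<Sum>y\<in>UNIV. heat_kernel P 0 $ x $ y)"
    by (intro DERIV_isconst_all) auto
  then show ?thesis by (simp add: heat_kernel_0 mat_def)
qed

lemma heat_kernel_stationary:
  assumes "stationary_distribution P \<pi>"
  shows "(\<Sum>x\<in>UNIV. \<pi> $ x * heat_kernel P t $ x $ y) = \<pi> $ y"
proof -
  have flow: "(\<Sum>x\<in>UNIV. \<pi> $ x * P $ x $ y) = \<pi> $ y" for y
    using assms by (simp add: stationary_distribution_def vector_matrix_mult_def vec_eq_iff mult.commute)
  have "((\<lambda>t. \<Sum>x\<in>UNIV. \<pi> $ x * heat_kernel P t $ x $ y) has_real_derivative 0) (at t)" for t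
  proof -
    have "(\<Sum>x\<in>UNIV. \<pi> $ x * ((P - mat 1) ** heat_kernel P t) $ x $ y)
        = (\<Sum>z\<in>UNIV. (\<Sum>x\<in>UNIV. \<pi> $ x * (P - mat 1) $ x $ z) * heat_kernel P t $ z $ y)"
      unfolding matrix_matrix_mult_def
      by (simp add: sum_distrib_left sum_distrib_right mult.assoc, subst sum.swap, rule refl)
    also have "\<dots> = 0"
      by (simp add: sum_subtractf mat_def right_diff_distrib flow if_distrib[of "\<lambda>c. _ * c"] cong: if_cong)
    finally have "(\<Sum>x\<in>UNIV. \<pi> $ x * ((P - mat 1) ** heat_kernel P t) $ x $ y) = 0" .
    moreover have "((\<lambda>t. \<Sum>x\<in>UNIV. \<pi> $ x * heat_kernel P t $ x $ y) has_real_derivative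
        (\<Sum>x\<in>UNIV. \<pi> $ x * ((P - mat 1) ** heat_kernel P t) $ x $ y)) (at t)"
      by (intro DERIV_sum DERIV_cmult DERIV_heat_kernel(1))
    ultimately show ?thesis by (simp only:)
  qed
  then have "(\<Sum>x\<in>UNIV. \<pi> $ x * heat_kernel P t $ x $ y) = (\<Sum>x\<in>UNIV. \<pi> $ x * heat_kernel P 0 $ x $ y)"
    by (intro DERIV_isconst_all) auto
  then show ?thesis by (simp add: heat_kernel_0 mat_def if_distrib[of "\<lambda>c. _ * c"] cong: if_cong)
qed

text \<open>By irreducibility, mass at any one state reaches every other state under some power of \<open>P\<close>,
  and all powers preserve \<open>\<pi>\<close>.\<close>

lemma stationary_pos:
  assumes irr: "irreducible_kernel P" and stat: "stationary_distribution P \<pi>"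
    and trans: "transition_kernel P"
  shows "0 < \<pi> $ y"
proof -
  have \<pi>: "\<And>x. 0 \<le> \<pi> $ x" "(\<Sum>x\<in>UNIV. \<pi> $ x) = 1" "\<pi> v* P = \<pi>"
    using stat by (auto simp: stationary_distribution_def)
  have power: "\<pi> v* matrix_power P n = \<pi>" for n
    by (induction n) (simp_all add: \<pi>(3) flip: vector_matrix_mul_assoc)
  obtain x where x: "0 < \<pi> $ x"
    using \<pi>(1,2) sum_nonpos[of UNIV "\<lambda>x. \<pi> $ x"] by (auto simp: not_le[symmetric] intro: ccontr)
  obtain n where n: "0 < matrix_power P n $ x $ y"
    using irr by (auto simp: irreducible_kernel_def)
  have "0 < matrix_power P n $ x $ y * \<pi> $ x" using x n by simp
  also have "\<dots> \<le> (\<Sum>z\<in>UNIV. matrix_power P n $ z $ y * \<pi> $ z)"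
    using trans \<pi>(1) by (intro member_le_sum mult_nonneg_nonneg matrix_power_nonneg)
      (auto simp: transition_kernel_def)
  also have "\<dots> = (\<pi> v* matrix_power P n) $ y" by (simp add: vector_matrix_mult_def mult.commute)
  also have "\<dots> = \<pi> $ y" by (simp add: power)
  finally show ?thesis .
qed

section \<open>Decay of the variance along the conductance profile\<close>

text \<open>A monotone function whose right increments are locally at least \<open>k * h\<close> grows at least like
  \<open>k * t\<close>. The set where this bound holds contains its supremum because of monotonicity, and the
  increments push any point of it before \<open>T\<close> further to the right. This takes the place of the
  chain rule in \<open>variance_decay\<close>: the conductance profile is a step function, so an integral of
  it need not be differentiable with respect to its upper limit.\<close>

lemma linear_growth_from_right_increments:
  fixes J :: "real \<Rightarrow> ennreal"
  assumes mono: "\<And>a b. 0 \<le> a \<Longrightarrow> a \<le> b \<Longrightarrow> b \<le> T \<Longrightarrow> J a \<le> J b"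
    and step: "\<And>a. 0 \<le> a \<Longrightarrow> a < T \<Longrightarrow>
      \<exists>d>0. \<forall>h. 0 < h \<longrightarrow> h < d \<longrightarrow> a + h \<le> T \<longrightarrow> J a + ennreal (k * h) \<le> J (a + h)"
    and "0 \<le> k" "0 \<le> T"
  shows "ennreal (k * T) \<le> J T"
proof -
  define A where "A = {s \<in> {0..T}. ennreal (k * s) \<le> J s}"
  have "0 \<in> A" using \<open>0 \<le> T\<close> by (simp add: A_def)
  have bdd: "bdd_above A" by (intro bdd_aboveI[of _ T]) (auto simp: A_def)
  define c where "c = Sup A"
  have "0 \<le> c" unfolding c_def using \<open>0 \<in> A\<close> bdd by (rule cSup_upper)
  have "c \<le> T" unfolding c_def using \<open>0 \<in> A\<close> by (intro cSup_least) (auto simp: A_def)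
  have "ennreal (k * c) \<le> J c"
  proof (cases "J c")
    case (real r)
    have bound: "k * s \<le> r" if "s \<in> A" for s
    proof -
      have "s \<le> c" unfolding c_def using that bdd by (rule cSup_upper)
      then have "ennreal (k * s) \<le> J c"
        using that mono[of s c] \<open>c \<le> T\<close> by (auto simp: A_def intro: order_trans)
      then show ?thesis using real by (simp add: ennreal_le_iff)
    qed
    have "s \<le> r / k" if "s \<in> A" "0 < k" for s
      using bound[OF that(1)] that(2) by (simp add: pos_le_divide_eq mult.commute)
    then have "c \<le> r / k" if "0 < k"
      using that \<open>0 \<in> A\<close> unfolding c_def by (intro cSup_least) auto
    then have "k * c \<le> r"
      using \<open>0 \<le> k\<close> real by (cases "k = 0") (auto simp: field_simps)
    then show ?thesis using real by (simp add: ennreal_leI)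
  qed simp
  moreover have "\<not> c < T"
  proof
    assume "c < T"
    then obtain d where "d > 0" and d: "\<And>h. 0 < h \<Longrightarrow> h < d \<Longrightarrow> c + h \<le> T \<Longrightarrow>
        J c + ennreal (k * h) \<le> J (c + h)"
      using step[OF \<open>0 \<le> c\<close>] by blast
    define h where "h = min (d / 2) (T - c)"
    have h: "0 < h" "h < d" "c + h \<le> T"
      using \<open>d > 0\<close> \<open>c < T\<close> by (auto simp: h_def min_def)
    have "ennreal (k * (c + h)) = ennreal (k * c) + ennreal (k * h)"
      using \<open>0 \<le> c\<close> h \<open>0 \<le> k\<close> by (simp add: distrib_left ennreal_plus)
    also have "\<dots> \<le> J c + ennreal (k * h)"
      using \<open>ennreal (k * c) \<le> J c\<close> by (rule add_right_mono)
    also have "\<dots> \<le> J (c + h)" using d h by simp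
    finally have "c + h \<in> A" using h \<open>0 \<le> c\<close> by (simp add: A_def)
    then have "c + h \<le> c" unfolding c_def using bdd by (rule cSup_upper)
    with h show False by simp
  qed
  ultimately show ?thesis using \<open>c \<le> T\<close> by (simp add: not_less)
qed

lemma conductance_profile_antimono:
  "r \<le> s \<Longrightarrow> conductance_profile P \<pi> s \<le> conductance_profile P \<pi> r"
  unfolding conductance_profile_def by (rule INF_superset_mono) auto

text \<open>Writing the infimum over a set that depends on \<open>r\<close> as one over all sets makes it a finite
  infimum of measurable functions.\<close>

lemma measurable_conductance_profile [measurable]:
  fixes P :: "real^'v^'v"
  shows "conductance_profile P \<pi> \<in> borel_measurable borel"
proof -
  have "conductance_profile P \<pi> r = (INF S\<in>UNIV.
      if S \<noteq> {} \<and> set_mass \<pi> S \<le> min r (1/2) then ennreal (set_conductance P \<pi> S) else top)" for r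
    unfolding conductance_profile_def
  proof (rule antisym)
    show "(INF S\<in>{S. S \<noteq> {} \<and> set_mass \<pi> S \<le> min r (1/2)}. ennreal (set_conductance P \<pi> S))
      \<le> (INF S\<in>UNIV. if S \<noteq> {} \<and> set_mass \<pi> S \<le> min r (1/2) then ennreal (set_conductance P \<pi> S) else top)"
      by (rule INF_greatest) (auto intro: INF_lower)
  next
    show "(INF S\<in>UNIV. if S \<noteq> {} \<and> set_mass \<pi> S \<le> min r (1/2) then ennreal (set_conductance P \<pi> S) else top)
      \<le> (INF S\<in>{S. S \<noteq> {} \<and> set_mass \<pi> S \<le> min r (1/2)}. ennreal (set_conductance P \<pi> S))"
    proof (rule INF_greatest)
      fix S :: "'v set" assume "S \<in> {S. S \<noteq> {} \<and> set_mass \<pi> S \<le> min r (1/2)}"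
      then show "(INF S\<in>UNIV. if S \<noteq> {} \<and> set_mass \<pi> S \<le> min r (1/2) then ennreal (set_conductance P \<pi> S) else top)
        \<le> ennreal (set_conductance P \<pi> S)"
        by (intro INF_lower2[of S]) auto
    qed
  qed
  from measurable_cong[OF this] show ?thesis by (rule iffD2) measurable
qed

lemma ennreal_inverse_antimono: "(a :: ennreal) \<le> b \<Longrightarrow> inverse b \<le> inverse a"
  including ennreal.lifting by transfer (rule ereal_inverse_antimono)

text \<open>The profile is decreasing, so \<open>1 / \<Phi>\<^sup>2\<close> is smallest at the left end point. The factor \<open>1 / u\<close>
  is smallest at the right one; with \<open>u = 4 / I\<close> and \<open>v = 4 / I'\<close> this costs nothing to first
  order, as \<open>(v - u) / v = (I - I') / I\<close>.\<close>

lemma profile_integral_ge: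
  assumes "0 < u"
  shows "8 / (ennreal v * (conductance_profile P \<pi> u)\<^sup>2) * ennreal (v - u) \<le> profile_integral P \<pi> u v"
proof -
  let ?c = "8 / (ennreal v * (conductance_profile P \<pi> u)\<^sup>2)"
  have "?c * ennreal (v - u) = (\<integral>\<^sup>+w\<in>{u..v}. ?c \<partial>lborel)"
    by (cases "u \<le> v") (simp_all add: nn_integral_cmult_indicator ennreal_neg)
  also have "\<dots> \<le> profile_integral P \<pi> u v"
    unfolding profile_integral_def
  proof (intro nn_integral_mono)
    fix w
    show "?c * indicator {u..v} w
        \<le> 8 / (ennreal w * (conductance_profile P \<pi> w)\<^sup>2) * indicator {u..v} w"
    proof (cases "w \<in> {u..v}")
      case True
      then have "ennreal w * (conductance_profile P \<pi> w)\<^sup>2 \<le> ennreal v * (conductance_profile P \<pi> u)\<^sup>2"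
        by (intro mult_mono power_mono conductance_profile_antimono ennreal_leI) auto
      then show ?thesis using True by (simp add: divide_ennreal_def ennreal_inverse_antimono mult_left_mono)
    qed simp
  qed
  finally show ?thesis .
qed

lemma profile_integral_split:
  assumes "a \<le> b" "b \<le> c"
  shows "profile_integral P \<pi> a b + profile_integral P \<pi> b c \<le> profile_integral P \<pi> a c"
proof -
  define F where "F u = 8 / (ennreal u * (conductance_profile P \<pi> u)\<^sup>2)" for u
  have [measurable]: "F \<in> borel_measurable borel" unfolding F_def by measurable
  have "profile_integral P \<pi> a b + profile_integral P \<pi> b c
      = (\<integral>\<^sup>+u. F u * indicator {a..b} u + F u * indicator {b..c} u \<partial>lborel)"
    unfolding profile_integral_def F_def[symmetric] by (subst nn_integral_add) auto
  also have "\<dots> \<le> (\<integral>\<^sup>+u\<in>{a..c}. F u \<partial>lborel)"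
    using AE_lborel_singleton[of b]
    by (intro nn_integral_mono_AE, elim eventually_mono)
      (use assms in \<open>auto simp: indicator_def\<close>)
  finally show ?thesis by (simp add: profile_integral_def F_def)
qed

lemma profile_integral_mono:
  assumes "a' \<le> a" "b \<le> b'"
  shows "profile_integral P \<pi> a b \<le> profile_integral P \<pi> a' b'"
  unfolding profile_integral_def using assms
  by (intro nn_integral_mono mult_left_mono) (auto simp: indicator_def)

lemma circulation_of_chain:
  assumes "transition_kernel P" "stationary_distribution P \<pi>"
  shows "circulation (\<lambda>x y. \<pi> $ x * P $ x $ y) (\<lambda>x. \<pi> $ x)"
  using assms
  by unfold_locales (auto simp: transition_kernel_def stationary_distribution_def
      vector_matrix_mult_def vec_eq_iff mult.commute simp flip: sum_distrib_left)

text \<open>The inequality \<open>dirichlet_ge_variance\<close> with \<open>\<phi>\<close> the value of the conductance profile. That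
  this value is finite is part of the claim: if the infimum were over no sets at all, the
  inequality would hold for all \<open>\<phi>\<close>, contradicting \<open>V > 0\<close>.\<close>

lemma dirichlet_ge_profile:
  fixes P :: "real^'v^'v" and \<pi> :: "real^'v"
  defines "E \<equiv> circulation.dirichlet (\<lambda>x y. \<pi> $ x * P $ x $ y)"
  assumes trans: "transition_kernel P" and stat: "stationary_distribution P \<pi>"
    and f: "\<And>x. 0 \<le> f x" "(\<Sum>x\<in>UNIV. \<pi> $ x * f x) = 1"
    and V: "V = (\<Sum>x\<in>UNIV. \<pi> $ x * (f x)\<^sup>2) - 1" "0 < V"
  obtains \<phi> where "0 \<le> \<phi>" "conductance_profile P \<pi> (4 / V) = ennreal \<phi>" "\<phi>\<^sup>2 / 4 * V \<le> E f"
proof -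
  interpret circulation "\<lambda>x y. \<pi> $ x * P $ x $ y" "\<lambda>x. \<pi> $ x"
    using trans stat by (rule circulation_of_chain)
  have bound: "\<phi>\<^sup>2 / 4 * V \<le> E f" if "0 \<le> \<phi>" "ennreal \<phi> \<le> conductance_profile P \<pi> (4 / V)" for \<phi>
    unfolding E_def
  proof (rule dirichlet_ge_variance[OF _ f V \<open>0 \<le> \<phi>\<close>])
    show "(\<Sum>x\<in>UNIV. \<pi> $ x) = 1" using stat by (simp add: stationary_distribution_def)
    fix S :: "'v set"
    assume S: "S \<noteq> {}" "(\<Sum>x\<in>S. \<pi> $ x) \<le> min (4 / V) (1/2)"
    have flow: "0 \<le> (\<Sum>x\<in>S. \<Sum>y\<in>-S. \<pi> $ x * P $ x $ y)"
      by (intro sum_nonneg Q_nonneg)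
    have mass: "0 \<le> (\<Sum>x\<in>S. \<pi> $ x)" by (intro sum_nonneg m_nonneg)
    have "ennreal \<phi> \<le> ennreal (set_conductance P \<pi> S)"
      by (rule order_trans[OF that(2)], unfold conductance_profile_def, rule INF_lower)
        (use S in \<open>simp add: set_mass_def\<close>)
    then have "\<phi> \<le> set_conductance P \<pi> S"
      using flow mass by (simp add: ennreal_le_iff set_conductance_def edge_flow_def set_mass_def)
    then have "\<phi> * (\<Sum>x\<in>S. \<pi> $ x) \<le> set_conductance P \<pi> S * (\<Sum>x\<in>S. \<pi> $ x)"
      using mass by (rule mult_right_mono)
    also have "\<dots> \<le> (\<Sum>x\<in>S. \<Sum>y\<in>-S. \<pi> $ x * P $ x $ y)"
      using flow by (simp add: set_conductance_def edge_flow_def set_mass_def)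
    finally show "\<phi> * (\<Sum>x\<in>S. \<pi> $ x) \<le> (\<Sum>x\<in>S. \<Sum>y\<in>-S. \<pi> $ x * P $ x $ y)" .
  qed
  show thesis
  proof (cases "conductance_profile P \<pi> (4 / V)")
    case (real \<phi>)
    then show thesis using bound that by simp
  next
    case top
    define \<phi> where "\<phi> = sqrt (4 * (E f + 1) / V)"
    have "0 \<le> E f" unfolding E_def by (rule dirichlet_nonneg)
    then have "0 \<le> \<phi>" "\<phi>\<^sup>2 = 4 * (E f + 1) / V" using V(2) by (auto simp: \<phi>_def)
    then have "E f + 1 \<le> E f" using bound[of \<phi>] V(2) top by (simp add: field_simps)
    then show thesis by simp
  qed
qed

text \<open>Let \<open>f t\<close> be densities whose variance \<open>V\<close> satisfies \<open>V' = - 2 E (f t)\<close>. By the spectral-profile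
  inequality, \<open>- V' / V \<ge> \<Phi>(4 / V)\<^sup>2 / 2\<close>. In the variable \<open>u = 4 / V\<close> one has \<open>du / u = - dV / V\<close>,
  so the integral of \<open>8 / (u \<Phi>(u)\<^sup>2)\<close> up to \<open>4 / V t\<close> grows at least at rate \<open>4\<close> in time,
  of which the rate \<open>2\<close> is used. If \<open>V t > \<epsilon>\<close> held, this integral would reach \<open>2 * t\<close> strictly
  before its upper limit \<open>4 / \<epsilon>\<close>, and so exceed \<open>2 * t\<close> in total.\<close>

lemma variance_decay:
  fixes P :: "real^'v^'v" and \<pi> :: "real^'v" and f :: "real \<Rightarrow> 'v \<Rightarrow> real"
  defines "E \<equiv> circulation.dirichlet (\<lambda>x y. \<pi> $ x * P $ x $ y)"
  defines "V \<equiv> \<lambda>t. (\<Sum>x\<in>UNIV. \<pi> $ x * (f t x)\<^sup>2) - 1"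
  assumes trans: "transition_kernel P" and stat: "stationary_distribution P \<pi>"
    and f: "\<And>t x. 0 \<le> t \<Longrightarrow> 0 \<le> f t x" "\<And>t. (\<Sum>x\<in>UNIV. \<pi> $ x * f t x) = 1"
    and deriv: "\<And>t. (V has_real_derivative - 2 * E (f t)) (at t)"
    and p: "0 < p" "V 0 \<le> 1 / p"
    and "0 < \<epsilon>" "0 \<le> t"
    and t: "profile_integral P \<pi> (4 * p) (4 / \<epsilon>) \<le> ennreal (2 * t)"
  shows "V t \<le> \<epsilon>"
proof (rule ccontr)
  assume "\<not> V t \<le> \<epsilon>"
  then have "\<epsilon> < V t" by simp
  interpret circulation "\<lambda>x y. \<pi> $ x * P $ x $ y" "\<lambda>x. \<pi> $ x"
    using trans stat by (rule circulation_of_chain)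
  have decreasing: "V b \<le> V a" if "a \<le> b" for a b
  proof (rule DERIV_nonpos_imp_nonincreasing[OF that])
    fix s
    show "\<exists>y. (V has_real_derivative y) (at s) \<and> y \<le> 0"
      using dirichlet_nonneg[of "f s"]
      by (intro exI[of _ "- 2 * E (f s)"] conjI deriv) (simp add: E_def)
  qed
  have above: "\<epsilon> < V s" if "s \<le> t" for s
    using decreasing[OF that] \<open>\<epsilon> < V t\<close> by simp
  then have pos: "0 < V s" if "s \<le> t" for s
    using that \<open>0 < \<epsilon>\<close> by (meson order_less_trans)
  have lower: "4 * p \<le> 4 / V s" if "0 \<le> s" "s \<le> t" for s
  proof -
    have "V s \<le> 1 / p" using decreasing[OF that(1)] p(2) by simp
    then show ?thesis using pos[OF that(2)] p(1) by (simp add: field_simps)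
  qed
  have rate: "\<exists>\<phi>>0. conductance_profile P \<pi> (4 / V s) = ennreal \<phi> \<and> \<phi>\<^sup>2 / 4 * V s \<le> E (f s)"
    if s: "0 \<le> s" "s \<le> t" for s
  proof -
    have "V s = (\<Sum>x\<in>UNIV. \<pi> $ x * (f s x)\<^sup>2) - 1" by (simp add: V_def)
    then obtain \<phi> where \<phi>: "0 \<le> \<phi>" "conductance_profile P \<pi> (4 / V s) = ennreal \<phi>" "\<phi>\<^sup>2 / 4 * V s \<le> E (f s)"
      using dirichlet_ge_profile[OF trans stat f(1)[OF s(1)] f(2) _ pos[OF s(2)]] unfolding E_def by blast
    \<comment> \<open>A zero of the profile before \<open>4 / \<epsilon>\<close> would make the integral infinite.\<close>
    have "\<phi> \<noteq> 0"
    proof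
      assume "\<phi> = 0"
      have "4 / V s < 4 / \<epsilon>"
        using above[OF s(2)] \<open>0 < \<epsilon>\<close> by (simp add: frac_less2)
      then have "8 / (ennreal (4 / \<epsilon>) * (conductance_profile P \<pi> (4 / V s))\<^sup>2) * ennreal (4 / \<epsilon> - 4 / V s) = top"
        using \<phi>(2) \<open>\<phi> = 0\<close> above[OF s(2)] by (simp add: ennreal_top_mult ennreal_divide_zero)
      then have "profile_integral P \<pi> (4 / V s) (4 / \<epsilon>) = top"
        using profile_integral_ge[of "4 / V s" "4 / \<epsilon>" P \<pi>] pos[OF s(2)] by (simp add: top_unique)
      then have "profile_integral P \<pi> (4 * p) (4 / \<epsilon>) = top"
        using profile_integral_mono[OF lower[OF s] order_refl, of P \<pi> "4 / \<epsilon>"] by (simp add: top_unique)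
      with t show False by (simp add: top_unique)
    qed
    with \<phi> show ?thesis by (intro exI[of _ \<phi>]) auto
  qed
  have increment: "ennreal (8 / \<phi>\<^sup>2 * ((v - u) / v)) \<le> profile_integral P \<pi> u v"
    if "conductance_profile P \<pi> u = ennreal \<phi>" "0 < \<phi>" "0 < u" "u \<le> v" for u v \<phi>
  proof -
    have "8 / (ennreal v * (ennreal \<phi>)\<^sup>2) = ennreal (8 / (v * \<phi>\<^sup>2))"
      using that divide_ennreal[of 8 "v * \<phi>\<^sup>2"] by (simp add: ennreal_mult ennreal_power)
    then have "8 / (ennreal v * (ennreal \<phi>)\<^sup>2) * ennreal (v - u) = ennreal (8 / (v * \<phi>\<^sup>2) * (v - u))"
      using that ennreal_mult[of "8 / (v * \<phi>\<^sup>2)" "v - u"] by simp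
    then show ?thesis
      using profile_integral_ge[OF \<open>0 < u\<close>, of v P \<pi>] that by (simp add: mult.commute)
  qed
  have grown: "ennreal (2 * t) \<le> profile_integral P \<pi> (4 * p) (4 / V t)"
  proof (rule linear_growth_from_right_increments)
    fix a b assume "0 \<le> a" "a \<le> b" "b \<le> t"
    then show "profile_integral P \<pi> (4 * p) (4 / V a) \<le> profile_integral P \<pi> (4 * p) (4 / V b)"
      using decreasing[of a b] pos[of a] pos[of b] by (intro profile_integral_mono) (auto simp: frac_le)
  next
    fix a assume a: "0 \<le> a" "a < t"
    obtain \<phi> where \<phi>: "0 < \<phi>" "conductance_profile P \<pi> (4 / V a) = ennreal \<phi>" "\<phi>\<^sup>2 / 4 * V a \<le> E (f a)"
      using rate[of a] a by auto
    have Va: "0 < V a" using pos a by simp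
    \<comment> \<open>The inequality gives decay at rate \<open>2 * D\<close>; asking only for \<open>D\<close> makes it strict, so that it persists on an interval to the right of \<open>a\<close>.\<close>
    define D where "D = \<phi>\<^sup>2 / 4 * V a"
    have "((\<lambda>s. V s + D * s) has_real_derivative - 2 * E (f a) + D) (at a)"
      by (intro DERIV_add deriv) (auto intro!: derivative_eq_intros)
    moreover have "- 2 * E (f a) + D < 0"
    proof -
      have "0 < D" using \<phi>(1) Va by (simp add: D_def)
      then show ?thesis using \<phi>(3) by (simp add: D_def)
    qed
    ultimately obtain d where "d > 0" and d: "\<And>h. 0 < h \<Longrightarrow> h < d \<Longrightarrow> V (a + h) + D * (a + h) < V a + D * a"
      using DERIV_neg_dec_right by blast
    show "\<exists>d>0. \<forall>h. 0 < h \<longrightarrow> h < d \<longrightarrow> a + h \<le> t \<longrightarrow>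
        profile_integral P \<pi> (4 * p) (4 / V a) + ennreal (2 * h) \<le> profile_integral P \<pi> (4 * p) (4 / V (a + h))"
    proof (intro exI[of _ d] conjI allI impI \<open>d > 0\<close>)
      fix h assume h: "0 < h" "h < d" "a + h \<le> t"
      define b where "b = a + h"
      have Vb: "0 < V b" using pos h by (simp add: b_def)
      have le: "4 / V a \<le> 4 / V b" using decreasing[of a b] h Vb by (simp add: b_def frac_le)
      have "D * h \<le> V a - V b" using d[OF h(1,2)] by (simp add: b_def algebra_simps)
      then have "2 * h \<le> 8 / \<phi>\<^sup>2 * ((V a - V b) / V a)"
        using \<phi>(1) Va by (simp add: D_def field_simps)
      also have "(V a - V b) / V a = (4 / V b - 4 / V a) / (4 / V b)"
        using Va Vb by (simp add: field_simps)
      finally have "ennreal (2 * h) \<le> profile_integral P \<pi> (4 / V a) (4 / V b)"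
        using increment[OF \<phi>(2,1) _ le] Va by (meson ennreal_leI order_trans divide_pos_pos zero_less_numeral)
      then have "profile_integral P \<pi> (4 * p) (4 / V a) + ennreal (2 * h)
          \<le> profile_integral P \<pi> (4 * p) (4 / V a) + profile_integral P \<pi> (4 / V a) (4 / V b)"
        by (rule add_left_mono)
      also have "\<dots> \<le> profile_integral P \<pi> (4 * p) (4 / V b)"
        using lower[of a] a le by (intro profile_integral_split) auto
      finally show "profile_integral P \<pi> (4 * p) (4 / V a) + ennreal (2 * h)
          \<le> profile_integral P \<pi> (4 * p) (4 / V (a + h))" by (simp add: b_def)
    qed
  qed (use \<open>0 \<le> t\<close> in auto)
  have "0 < profile_integral P \<pi> (4 / V t) (4 / \<epsilon>)"
  proof -
    obtain \<phi> where \<phi>: "0 < \<phi>" "conductance_profile P \<pi> (4 / V t) = ennreal \<phi>"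
      using rate[of t] \<open>0 \<le> t\<close> by auto
    have less: "4 / V t < 4 / \<epsilon>" using \<open>\<epsilon> < V t\<close> \<open>0 < \<epsilon>\<close> by (simp add: frac_less2)
    then have "0 < 8 / \<phi>\<^sup>2 * ((4 / \<epsilon> - 4 / V t) / (4 / \<epsilon>))"
      using \<phi>(1) \<open>0 < \<epsilon>\<close> by (intro mult_pos_pos divide_pos_pos) auto
    then show ?thesis
      using pos[of t]
      by (intro order_less_le_trans[OF _ increment[OF \<phi>(2,1) _ less_imp_le[OF less]]]) auto
  qed
  then have "ennreal (2 * t) + 0 < ennreal (2 * t) + profile_integral P \<pi> (4 / V t) (4 / \<epsilon>)"
    by (subst ennreal_add_left_cancel_less) simp
  also have "\<dots> \<le> profile_integral P \<pi> (4 * p) (4 / V t) + profile_integral P \<pi> (4 / V t) (4 / \<epsilon>)"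
    using grown by (rule add_right_mono)
  also have "\<dots> \<le> profile_integral P \<pi> (4 * p) (4 / \<epsilon>)"
    using lower[of t] \<open>0 \<le> t\<close> above[of t] \<open>0 < \<epsilon>\<close> by (intro profile_integral_split) (auto simp: frac_le)
  finally show False using t by simp
qed

section \<open>Pointwise mixing\<close>

text \<open>The densities \<open>h_t(x,z) / \<pi>(z)\<close> of the chain started at \<open>x\<close>. They evolve by the time reversal
  of \<open>P\<close>, which has the same Dirichlet form. The variance at time \<open>0\<close> is
  \<open>1 / \<pi>(x) - 1\<close>, hence less than \<open>1 / p\<close>.\<close>

lemma heat_kernel_row_variance:
  fixes P :: "real^'v^'v" and \<pi> :: "real^'v"
  assumes trans: "transition_kernel P" and stat: "stationary_distribution P \<pi>"
    and pos: "\<And>z. 0 < \<pi> $ z"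
    and p: "0 < p" "p \<le> \<pi> $ x" and "0 < \<epsilon>" "0 \<le> t"
    and t: "profile_integral P \<pi> (4 * p) (4 / \<epsilon>) \<le> ennreal (2 * t)"
  shows "(\<Sum>z\<in>UNIV. \<pi> $ z * (heat_kernel P t $ x $ z / \<pi> $ z)\<^sup>2) - 1 \<le> \<epsilon>"
proof -
  interpret circulation "\<lambda>x y. \<pi> $ x * P $ x $ y" "\<lambda>x. \<pi> $ x"
    using trans stat by (rule circulation_of_chain)
  define f where "f t z = heat_kernel P t $ x $ z / \<pi> $ z" for t z
  have density: "heat_kernel P t $ x $ z = \<pi> $ z * f t z" for t z
    using pos[of z] by (simp add: f_def)
  have deriv: "((\<lambda>t. (\<Sum>z\<in>UNIV. \<pi> $ z * (f t z)\<^sup>2) - 1) has_real_derivative - 2 * dirichlet (f t)) (at t)" for t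
  proof -
    have f': "((\<lambda>t. f t z) has_real_derivative (heat_kernel P t ** (P - mat 1)) $ x $ z / \<pi> $ z) (at t)" for z
      unfolding f_def by (intro DERIV_cdivide DERIV_heat_kernel(2))
    have "((\<lambda>t. (\<Sum>z\<in>UNIV. \<pi> $ z * (f t z)\<^sup>2) - 1) has_real_derivative
        (\<Sum>z\<in>UNIV. \<pi> $ z * (2 * f t z * ((heat_kernel P t ** (P - mat 1)) $ x $ z / \<pi> $ z))) - 0) (at t)"
      by (intro DERIV_diff DERIV_const DERIV_sum DERIV_cmult)
        (use DERIV_power[OF f', where n = 2] in \<open>simp add: mult_ac\<close>)
    also have "(\<Sum>z\<in>UNIV. \<pi> $ z * (2 * f t z * ((heat_kernel P t ** (P - mat 1)) $ x $ z / \<pi> $ z))) - 0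
        = - 2 * dirichlet (f t)"
    proof -
      have generator: "(heat_kernel P t ** (P - mat 1)) $ x $ z
          = (\<Sum>w\<in>UNIV. \<pi> $ w * P $ w $ z * f t w) - \<pi> $ z * f t z" for z
        by (simp add: matrix_matrix_mult_def density mat_def right_diff_distrib sum_subtractf mult_ac
            if_distrib[of "\<lambda>c. _ * c"] cong: if_cong)
      have cancel: "\<pi> $ z * (2 * f t z * (c / \<pi> $ z)) = 2 * (f t z * c)" for c z
        using pos[of z] by simp
      have "\<pi> $ z * (2 * f t z * ((heat_kernel P t ** (P - mat 1)) $ x $ z / \<pi> $ z))
          = 2 * (\<Sum>w\<in>UNIV. \<pi> $ w * P $ w $ z * (f t w * f t z)) - 2 * (\<pi> $ z * (f t z)\<^sup>2)" for z
        unfolding cancel generator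
        by (simp add: right_diff_distrib sum_distrib_left power2_eq_square mult_ac)
      then show ?thesis
        unfolding dirichlet_eq sum.swap[of "\<lambda>w z. \<pi> $ w * P $ w $ z * (f t w * f t z)"]
        by (simp add: sum_subtractf flip: sum_distrib_left)
    qed
    finally show ?thesis .
  qed
  have "\<pi> $ z * (f 0 z)\<^sup>2 = (if z = x then 1 / \<pi> $ x else 0)" for z
    using pos[of z] by (simp add: f_def heat_kernel_0 mat_def power2_eq_square)
  then have "(\<Sum>z\<in>UNIV. \<pi> $ z * (f 0 z)\<^sup>2) = 1 / \<pi> $ x" by simp
  also have "\<dots> \<le> 1 / p" using p by (intro divide_left_mono) auto
  finally have initial: "(\<Sum>z\<in>UNIV. \<pi> $ z * (f 0 z)\<^sup>2) - 1 \<le> 1 / p" by simp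
  have nonneg: "0 \<le> f t z" if "0 \<le> t" for t z
    unfolding f_def using heat_kernel_nonneg[OF trans that] pos[of z] by simp
  have mean: "(\<Sum>z\<in>UNIV. \<pi> $ z * f t z) = 1" for t
    using heat_kernel_row_sum[OF trans, of t x] by (simp add: density)
  have "(\<Sum>z\<in>UNIV. \<pi> $ z * (f t z)\<^sup>2) - 1 \<le> \<epsilon>"
    by (rule variance_decay[where f = f,
          OF trans stat nonneg mean deriv p(1) initial \<open>0 < \<epsilon>\<close> \<open>0 \<le> t\<close> t])
  then show ?thesis by (simp only: f_def)
qed

text \<open>The densities \<open>h_t(z,y) / \<pi>(y)\<close> as functions of the starting state \<open>z\<close>; here the evolution
  is by \<open>P\<close> itself, and the mean is \<open>1\<close> by stationarity.\<close>

lemma heat_kernel_column_variance: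
  fixes P :: "real^'v^'v" and \<pi> :: "real^'v"
  assumes trans: "transition_kernel P" and stat: "stationary_distribution P \<pi>"
    and pos: "\<And>z. 0 < \<pi> $ z"
    and p: "0 < p" "p \<le> \<pi> $ y" and "0 < \<epsilon>" "0 \<le> t"
    and t: "profile_integral P \<pi> (4 * p) (4 / \<epsilon>) \<le> ennreal (2 * t)"
  shows "(\<Sum>z\<in>UNIV. \<pi> $ z * (heat_kernel P t $ z $ y / \<pi> $ y)\<^sup>2) - 1 \<le> \<epsilon>"
proof -
  interpret circulation "\<lambda>x y. \<pi> $ x * P $ x $ y" "\<lambda>x. \<pi> $ x"
    using trans stat by (rule circulation_of_chain)
  define f where "f t z = heat_kernel P t $ z $ y / \<pi> $ y" for t z
  have deriv: "((\<lambda>t. (\<Sum>z\<in>UNIV. \<pi> $ z * (f t z)\<^sup>2) - 1) has_real_derivative - 2 * dirichlet (f t)) (at t)" for t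
  proof -
    have f': "((\<lambda>t. f t z) has_real_derivative ((P - mat 1) ** heat_kernel P t) $ z $ y / \<pi> $ y) (at t)" for z
      unfolding f_def by (intro DERIV_cdivide DERIV_heat_kernel(1))
    have "((\<lambda>t. (\<Sum>z\<in>UNIV. \<pi> $ z * (f t z)\<^sup>2) - 1) has_real_derivative
        (\<Sum>z\<in>UNIV. \<pi> $ z * (2 * f t z * (((P - mat 1) ** heat_kernel P t) $ z $ y / \<pi> $ y))) - 0) (at t)"
      by (intro DERIV_diff DERIV_const DERIV_sum DERIV_cmult)
        (use DERIV_power[OF f', where n = 2] in \<open>simp add: mult_ac\<close>)
    also have "(\<Sum>z\<in>UNIV. \<pi> $ z * (2 * f t z * (((P - mat 1) ** heat_kernel P t) $ z $ y / \<pi> $ y))) - 0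
        = - 2 * dirichlet (f t)"
    proof -
      have "((P - mat 1) ** heat_kernel P t) $ z $ y / \<pi> $ y
          = (\<Sum>w\<in>UNIV. P $ z $ w * f t w) - f t z" for z
        by (simp add: matrix_diff_mult diff_divide_distrib f_def)
          (simp add: matrix_matrix_mult_def sum_divide_distrib)
      then have "\<pi> $ z * (2 * f t z * (((P - mat 1) ** heat_kernel P t) $ z $ y / \<pi> $ y))
          = 2 * (\<Sum>w\<in>UNIV. \<pi> $ z * P $ z $ w * (f t z * f t w)) - 2 * (\<pi> $ z * (f t z)\<^sup>2)" for z
        by (simp add: right_diff_distrib sum_distrib_left power2_eq_square mult_ac)
      then show ?thesis
        unfolding dirichlet_eq by (simp add: sum_subtractf flip: sum_distrib_left)
    qed
    finally show ?thesis .
  qed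
  have "\<pi> $ z * (f 0 z)\<^sup>2 = (if z = y then 1 / \<pi> $ y else 0)" for z
    using pos[of z] by (simp add: f_def heat_kernel_0 mat_def power2_eq_square)
  then have "(\<Sum>z\<in>UNIV. \<pi> $ z * (f 0 z)\<^sup>2) = 1 / \<pi> $ y" by simp
  also have "\<dots> \<le> 1 / p" using p by (intro divide_left_mono) auto
  finally have initial: "(\<Sum>z\<in>UNIV. \<pi> $ z * (f 0 z)\<^sup>2) - 1 \<le> 1 / p" by simp
  have nonneg: "0 \<le> f t z" if "0 \<le> t" for t z
    unfolding f_def using heat_kernel_nonneg[OF trans that] pos[of y] by simp
  have mean: "(\<Sum>z\<in>UNIV. \<pi> $ z * f t z) = 1" for t
    using heat_kernel_stationary[OF stat, of t y] pos[of y]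
    by (simp add: f_def flip: sum_divide_distrib)
  have "(\<Sum>z\<in>UNIV. \<pi> $ z * (f t z)\<^sup>2) - 1 \<le> \<epsilon>"
    by (rule variance_decay[where f = f,
          OF trans stat nonneg mean deriv p(1) initial \<open>0 < \<epsilon>\<close> \<open>0 \<le> t\<close> t])
  then show ?thesis by (simp only: f_def)
qed

text \<open>By the semigroup law, the relative deviation at time \<open>s + t\<close> is the \<open>\<pi>\<close>-inner product of the
  centred densities at the times \<open>s\<close> and \<open>t\<close>, and hence at most the mean of their squared
  norms.\<close>

lemma heat_kernel_deviation:
  fixes P :: "real^'v^'v" and \<pi> :: "real^'v"
  assumes trans: "transition_kernel P" and stat: "stationary_distribution P \<pi>"
    and pos: "\<And>z. 0 < \<pi> $ z"
  shows "\<bar>(heat_kernel P (s + t) $ x $ y - \<pi> $ y) / \<pi> $ y\<bar>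
    \<le> (((\<Sum>z\<in>UNIV. \<pi> $ z * (heat_kernel P s $ x $ z / \<pi> $ z)\<^sup>2) - 1)
       + ((\<Sum>z\<in>UNIV. \<pi> $ z * (heat_kernel P t $ z $ y / \<pi> $ y)\<^sup>2) - 1)) / 2"
proof -
  define f g where "f z = heat_kernel P s $ x $ z / \<pi> $ z"
    and "g z = heat_kernel P t $ z $ y / \<pi> $ y" for z
  have total: "(\<Sum>z\<in>UNIV. \<pi> $ z) = 1" using stat by (simp add: stationary_distribution_def)
  have nonneg: "0 \<le> \<pi> $ z" for z using pos[of z] by simp
  have \<pi>f: "\<pi> $ z * f z = heat_kernel P s $ x $ z" for z
    using pos[of z] by (simp add: f_def)
  have mean_f: "(\<Sum>z\<in>UNIV. \<pi> $ z * f z) = 1"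
    using heat_kernel_row_sum[OF trans, of s x] by (simp add: \<pi>f)
  have mean_g: "(\<Sum>z\<in>UNIV. \<pi> $ z * g z) = 1"
    using heat_kernel_stationary[OF stat, of t y] pos[of y] by (simp add: g_def flip: sum_divide_distrib)
  have variance: "(\<Sum>z\<in>UNIV. \<pi> $ z * (h z - 1)\<^sup>2) = (\<Sum>z\<in>UNIV. \<pi> $ z * (h z)\<^sup>2) - 1"
    if "(\<Sum>z\<in>UNIV. \<pi> $ z * h z) = 1" for h
  proof -
    have "\<pi> $ z * (h z - 1)\<^sup>2 = \<pi> $ z * (h z)\<^sup>2 - 2 * (\<pi> $ z * h z) + \<pi> $ z" for z
      by (simp add: power2_eq_square algebra_simps)
    then show ?thesis using that total by (simp add: sum.distrib sum_subtractf flip: sum_distrib_left)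
  qed
  have "(heat_kernel P (s + t) $ x $ y - \<pi> $ y) / \<pi> $ y = (\<Sum>z\<in>UNIV. \<pi> $ z * f z * g z) - 1"
    using pos[of y] by (simp add: \<pi>f heat_kernel_add matrix_matrix_mult_def g_def sum_divide_distrib diff_divide_distrib)
  also have "\<dots> = (\<Sum>z\<in>UNIV. \<pi> $ z * ((f z - 1) * (g z - 1)))"
    using total mean_f mean_g by (simp add: algebra_simps sum.distrib sum_subtractf)
  finally have "\<bar>(heat_kernel P (s + t) $ x $ y - \<pi> $ y) / \<pi> $ y\<bar>
      \<le> (\<Sum>z\<in>UNIV. \<bar>\<pi> $ z * ((f z - 1) * (g z - 1))\<bar>)" by simp
  also have "\<dots> \<le> (\<Sum>z\<in>UNIV. \<pi> $ z * (((f z - 1)\<^sup>2 + (g z - 1)\<^sup>2) / 2))"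
  proof (intro sum_mono)
    fix z
    have "\<bar>(f z - 1) * (g z - 1)\<bar> \<le> ((f z - 1)\<^sup>2 + (g z - 1)\<^sup>2) / 2"
      using sum_squares_bound[of "\<bar>f z - 1\<bar>" "\<bar>g z - 1\<bar>"] by (simp add: abs_mult)
    then show "\<bar>\<pi> $ z * ((f z - 1) * (g z - 1))\<bar> \<le> \<pi> $ z * (((f z - 1)\<^sup>2 + (g z - 1)\<^sup>2) / 2)"
      using nonneg[of z] by (simp only: abs_mult abs_of_nonneg mult_left_mono)
  qed
  also have "\<dots> = ((\<Sum>z\<in>UNIV. \<pi> $ z * (f z - 1)\<^sup>2) + (\<Sum>z\<in>UNIV. \<pi> $ z * (g z - 1)\<^sup>2)) / 2"
    by (simp add: distrib_left sum.distrib add_divide_distrib flip: sum_divide_distrib)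
  also have "\<dots> = (((\<Sum>z\<in>UNIV. \<pi> $ z * (f z)\<^sup>2) - 1) + ((\<Sum>z\<in>UNIV. \<pi> $ z * (g z)\<^sup>2) - 1)) / 2"
    by (simp only: variance mean_f mean_g)
  finally show ?thesis by (simp only: f_def g_def)
qed

theorem theorem13:
  fixes P :: "real^'v^'v" and \<pi> :: "real^'v" and \<epsilon> :: real
  assumes "transition_kernel P"
    and "irreducible_kernel P"
    and "stationary_distribution P \<pi>"
    and "\<epsilon> > 0"
  shows "ennreal (uniform_mixing_time P \<pi> \<epsilon>)
           \<le> profile_integral P \<pi> (4 * (MIN x. \<pi> $ x)) (4 / \<epsilon>)
         \<and> (\<forall>x y. \<forall>t\<ge>0.
              ennreal t \<ge> profile_integral P \<pi> (4 * min (\<pi> $ x) (\<pi> $ y)) (4 / \<epsilon>)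
              \<longrightarrow> \<bar>(heat_kernel P t $ x $ y - \<pi> $ y) / \<pi> $ y\<bar> \<le> \<epsilon>)"
proof
  have pos: "0 < \<pi> $ z" for z
    using assms(2,3,1) by (rule stationary_pos)
  show pointwise: "\<forall>x y. \<forall>t\<ge>0.
      ennreal t \<ge> profile_integral P \<pi> (4 * min (\<pi> $ x) (\<pi> $ y)) (4 / \<epsilon>)
      \<longrightarrow> \<bar>(heat_kernel P t $ x $ y - \<pi> $ y) / \<pi> $ y\<bar> \<le> \<epsilon>"
  proof (intro allI impI)
    fix x y and t :: real
    assume t: "0 \<le> t" "profile_integral P \<pi> (4 * min (\<pi> $ x) (\<pi> $ y)) (4 / \<epsilon>) \<le> ennreal t"
    let ?p = "min (\<pi> $ x) (\<pi> $ y)" and ?s = "t / 2"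
    \<comment> \<open>Half of the time goes to each of the two factors of the semigroup law.\<close>
    have p: "0 < ?p" "?p \<le> \<pi> $ x" "?p \<le> \<pi> $ y" and s: "0 \<le> ?s"
      and int: "profile_integral P \<pi> (4 * ?p) (4 / \<epsilon>) \<le> ennreal (2 * ?s)"
      using pos t by simp_all
    have "\<bar>(heat_kernel P (?s + ?s) $ x $ y - \<pi> $ y) / \<pi> $ y\<bar> \<le> (\<epsilon> + \<epsilon>) / 2"
      by (rule order_trans[OF heat_kernel_deviation[OF assms(1,3) pos]], intro divide_right_mono add_mono
          heat_kernel_row_variance[OF assms(1,3) pos p(1,2) assms(4) s int]
          heat_kernel_column_variance[OF assms(1,3) pos p(1,3) assms(4) s int]) simp
    then show "\<bar>(heat_kernel P t $ x $ y - \<pi> $ y) / \<pi> $ y\<bar> \<le> \<epsilon>" by simp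
  qed
  let ?I = "profile_integral P \<pi> (4 * (MIN x. \<pi> $ x)) (4 / \<epsilon>)"
  show "ennreal (uniform_mixing_time P \<pi> \<epsilon>) \<le> ?I"
  proof (cases ?I)
    case (real T)
    \<comment> \<open>The admissible times form a closed set, so the \<open>LEAST\<close> in the definition is its infimum.\<close>
    define M where "M = {t. 0 \<le> t \<and> (\<forall>x y. \<bar>(heat_kernel P t $ x $ y - \<pi> $ y) / \<pi> $ y\<bar> \<le> \<epsilon>)}"
    have "T \<in> M"
    proof -
      have "\<bar>(heat_kernel P T $ x $ y - \<pi> $ y) / \<pi> $ y\<bar> \<le> \<epsilon>" for x y
      proof -
        have "profile_integral P \<pi> (4 * min (\<pi> $ x) (\<pi> $ y)) (4 / \<epsilon>) \<le> ?I"
          by (intro profile_integral_mono) auto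
        then show ?thesis using pointwise real by simp
      qed
      with real show ?thesis by (simp add: M_def)
    qed
    moreover have "closed M"
    proof -
      have entry: "continuous_on UNIV (\<lambda>t. heat_kernel P t $ x $ y)" for x y
        by (intro continuous_at_imp_continuous_on ballI DERIV_isCont[OF DERIV_heat_kernel(1)])
      show ?thesis
        unfolding M_def
        by (intro closed_Collect_conj closed_Collect_all closed_Collect_le continuous_on_rabs
            continuous_on_divide continuous_on_diff continuous_on_const continuous_on_id entry)
          (use pos in \<open>auto simp: less_imp_neq[THEN not_sym]\<close>)
    qed
    moreover have "bdd_below M" by (intro bdd_belowI[of _ 0]) (simp add: M_def)
    ultimately have "Inf M \<in> M" "Inf M \<le> T"
      by (auto intro: closed_contains_Inf cInf_lower)
    moreover have "uniform_mixing_time P \<pi> \<epsilon> = Inf M"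
      unfolding uniform_mixing_time_def
    proof (rule Least_equality)
      show "0 \<le> Inf M \<and> (\<forall>x y. \<bar>(heat_kernel P (Inf M) $ x $ y - \<pi> $ y) / \<pi> $ y\<bar> \<le> \<epsilon>)"
        using \<open>Inf M \<in> M\<close> by (simp add: M_def)
    next
      fix t assume "0 \<le> t \<and> (\<forall>x y. \<bar>(heat_kernel P t $ x $ y - \<pi> $ y) / \<pi> $ y\<bar> \<le> \<epsilon>)"
      then have "t \<in> M" by (simp add: M_def)
      then show "Inf M \<le> t" using \<open>bdd_below M\<close> by (rule cInf_lower)
    qed
    ultimately show ?thesis using real by (simp add: ennreal_leI)
  qed simp
qed

end
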